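(* Let $m\geq 3$ be an integer, let $\beta\in(0,1)$ be a real number satisfying $\beta^2-m\beta=-1$, and let $(G_n)_{n\geq 0}$ be the integer sequence defined by $G_0=0$, $G_1=1$, $G_{n+2}=mG_{n+1}-G_n$ for $n\geq 0$. For an integer $i\geq 1$ put $$V_i=\bigl\{kG_{i+1}-(\lfloor k\beta\rfloor+1)G_i \,\bigm|\, k\in\mathbb{Z}\bigr\}.$$ Then for every $j\in\mathbb{Z}$ we have $$\bigl\lfloor \beta(j+G_i)\bigr\rfloor = \lfloor \beta j\rfloor + G_{i-1}+\varepsilon_i(j),\qquad\text{where}\quad \varepsilon_i(j)=\begin{cases}0 & \text{if } j\notin V_i,\\ 1 & \text{if } j\in V_i.\end{cases}$$ Moreover, the density of the set $V_i$ of mismatches exists and is equal to $\beta^i$.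
   Context: $\lfloor x\rfloor$ denotes the greatest integer not exceeding the real number $x$. The density (frequency) of a set $S\subset\mathbb{Z}$ is $\lim_{n\to\infty}\frac{\#\{j\in S\,\mid\, -n\leq j\leq n\}}{2n+1}$. *)

theory Defs
  imports Complex_Main
begin

fun G :: "int \<Rightarrow> nat \<Rightarrow> int" where
  "G m 0 = 0"
| "G m (Suc 0) = 1"
| "G m (Suc (Suc n)) = m * G m (Suc n) - G m n"

definition V :: "int \<Rightarrow> real \<Rightarrow> nat \<Rightarrow> int set" where
  "V m \<beta> i = {k * G m (i + 1) - (\<lfloor>real_of_int k * \<beta>\<rfloor> + 1) * G m i | k :: int. True}"

definition mismatch :: "int \<Rightarrow> real \<Rightarrow> nat \<Rightarrow> int \<Rightarrow> int" where
  "mismatch m \<beta> i j = (if j \<in> V m \<beta> i then 1 else 0)"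

text \<open>The density need not exist, so it is a relation between a set and a number.\<close>

definition has_density :: "int set \<Rightarrow> real \<Rightarrow> bool" where
  "has_density S d \<longleftrightarrow>
    (\<lambda>n::nat. real (card {j \<in> S. - int n \<le> j \<and> j \<le> int n}) / (2 * real n + 1))
      \<longlonglongrightarrow> d"

end

theory Submission
  imports Defs
begin

text \<open>
  Since \<open>\<beta> * G i = G (i - 1) + \<beta> ^ i\<close>, shifting \<open>j\<close> by \<open>G i\<close> raises \<open>\<beta> * j\<close> by an integer plus
  \<open>\<beta> ^ i\<close>, so a mismatch occurs iff \<open>frac (\<beta> * j) \<ge> 1 - \<beta> ^ i\<close>. By the identity
  \<open>(G i)\<^sup>2 - G (i + 1) * G (i - 1) = 1\<close> every pair of integers \<open>(j, p)\<close> has the form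
  \<open>(k * G (i + 1) - l * G i, k * G i - l * G (i - 1))\<close>, and then
  \<open>\<beta> * j - p = \<beta> ^ i * (k * \<beta> - l)\<close>; this turns the condition on \<open>frac (\<beta> * j)\<close> into
  \<open>l = \<lfloor>k * \<beta>\<rfloor> + 1\<close>. For the density, the mismatch at \<open>j\<close> equals
  \<open>\<beta> ^ i - (frac (\<beta> * (j + G i)) - frac (\<beta> * j))\<close>, and the bracket telescopes to a bounded sum.
\<close>

text \<open>The recurrence leaves this expression invariant. It is the determinant of the map from
  \<open>(k, l)\<close> to \<open>(j, p)\<close> inverted in \<open>in_V_iff\<close>, so that map is
  a bijection of integer pairs.\<close>

lemma G_cassini: "(G m (Suc n))\<^sup>2 - G m (Suc (Suc n)) * G m n = 1"
proof (induction n)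
  case (Suc n)
  have "(G m (Suc (Suc n)))\<^sup>2 - G m (Suc (Suc (Suc n))) * G m (Suc n)
      = (G m (Suc n))\<^sup>2 - G m (Suc (Suc n)) * G m n"
    by (simp add: power2_eq_square algebra_simps)
  then show ?case using Suc.IH by simp
qed simp

lemma G_nonneg:
  assumes "m \<ge> 2"
  shows "0 \<le> G m n"
proof -
  \<comment> \<open>The recurrence subtracts a term, so nonnegativity is not inductive by itself;
    monotonicity is carried along.\<close>
  have "0 \<le> G m n \<and> G m n \<le> G m (Suc n)"
  proof (induction n)
    case (Suc n)
    have "2 * G m (Suc n) \<le> m * G m (Suc n)"
      using Suc.IH assms by (intro mult_right_mono) auto
    then show ?case using Suc.IH by simp
  qed simp
  then show ?thesis by simp
qed

text \<open>Both sides obey the recurrence of \<open>G\<close>, because \<beta> is a root of its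
  characteristic polynomial.\<close>

lemma beta_mult_G:
  fixes \<beta> :: real
  assumes "\<beta>\<^sup>2 - real_of_int m * \<beta> = -1"
  shows "\<beta> * G m (Suc n) = G m n + \<beta> ^ Suc n"
proof (induction n rule: less_induct)
  case (less n)
  have sq: "\<beta> * \<beta> = m * \<beta> - 1"
    using assms by (simp add: power2_eq_square)
  consider "n = 0" | "n = 1" | l where "n = Suc (Suc l)"
    by (metis One_nat_def not0_implies_Suc)
  then show ?case
  proof cases
    case 3
    have "\<beta> * G m (Suc n) = m * (\<beta> * G m (Suc (Suc l))) - \<beta> * G m (Suc l)"
      by (simp add: 3 algebra_simps)
    also have "\<dots> = m * (G m (Suc l) + \<beta> ^ Suc (Suc l)) - (G m l + \<beta> ^ Suc l)"
      using less.IH[of "Suc l"] less.IH[of l] by (simp add: 3)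
    also have "\<dots> = G m n + \<beta> ^ Suc l * (m * \<beta> - 1)"
      by (simp add: 3 algebra_simps)
    also have "\<dots> = G m n + \<beta> ^ Suc n"
      by (simp add: 3 flip: sq)
    finally show ?thesis .
  qed (use sq in \<open>simp_all add: algebra_simps\<close>)
qed

lemma in_V_iff:
  fixes \<beta> :: real
  assumes "0 < \<beta>" and \<beta>: "\<beta>\<^sup>2 - real_of_int m * \<beta> = -1"
  shows "j \<in> V m \<beta> (Suc n) \<longleftrightarrow> (\<exists>p::int. p - \<beta> ^ Suc n \<le> \<beta> * j \<and> \<beta> * j < p)"
proof -
  have key: "\<beta> * (k * G m (Suc (Suc n)) - l * G m (Suc n))
      = (k * G m (Suc n) - l * G m n) + \<beta> ^ Suc n * (k * \<beta> - l)" for k l :: int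
  proof -
    have "\<beta> * (k * G m (Suc (Suc n)) - l * G m (Suc n))
        = k * (\<beta> * G m (Suc (Suc n))) - l * (\<beta> * G m (Suc n))"
      by (simp add: algebra_simps del: G.simps)
    then show ?thesis
      unfolding beta_mult_G[OF \<beta>] by (simp add: algebra_simps del: G.simps)
  qed
  have pos: "0 < \<beta> ^ Suc n" using assms(1) by simp
  \<comment> \<open>With \<open>x = k * \<beta> - l\<close>, the window of length
    \<open>\<beta> ^ Suc n\<close> below \<open>p\<close> becomes a unit interval, which determines
    \<open>l\<close> from \<open>k\<close>.\<close>
  have scale: "p - \<beta> ^ Suc n \<le> p + \<beta> ^ Suc n * x \<and> p + \<beta> ^ Suc n * x < p \<longleftrightarrow> -1 \<le> x \<and> x < 0"
    for p x :: real
  proof -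
    have "\<beta> ^ Suc n * (-1) \<le> \<beta> ^ Suc n * x \<longleftrightarrow> -1 \<le> x"
      using pos by (rule mult_le_cancel_left_pos)
    moreover have "\<beta> ^ Suc n * x < \<beta> ^ Suc n * 0 \<longleftrightarrow> x < 0"
      using pos by (rule mult_less_cancel_left_pos)
    ultimately show ?thesis by auto
  qed
  show ?thesis
  proof
    assume "j \<in> V m \<beta> (Suc n)"
    then obtain k where j: "j = k * G m (Suc (Suc n)) - (\<lfloor>k * \<beta>\<rfloor> + 1) * G m (Suc n)"
      unfolding V_def by auto
    define l where "l = \<lfloor>k * \<beta>\<rfloor> + 1"
    have "-1 \<le> k * \<beta> - l" "k * \<beta> - l < 0"
      unfolding l_def by linarith+
    moreover have "\<beta> * j = (k * G m (Suc n) - l * G m n) + \<beta> ^ Suc n * (k * \<beta> - l)"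
      using key[of k l] by (simp add: j l_def del: G.simps)
    ultimately show "\<exists>p::int. p - \<beta> ^ Suc n \<le> \<beta> * j \<and> \<beta> * j < p"
      using scale by (metis of_int_diff of_int_mult)
  next
    assume "\<exists>p::int. p - \<beta> ^ Suc n \<le> \<beta> * j \<and> \<beta> * j < p"
    then obtain p :: int where p: "p - \<beta> ^ Suc n \<le> \<beta> * j" "\<beta> * j < p" by blast
    \<comment> \<open>Cramer's rule for the linear system expressing \<open>j\<close> and
      \<open>p\<close> through \<open>k\<close> and \<open>l\<close>, whose determinant is
      1.\<close>
    define k where "k = G m (Suc n) * p - G m n * j"
    define l where "l = G m (Suc (Suc n)) * p - G m (Suc n) * j"
    have "k * G m (Suc (Suc n)) - l * G m (Suc n)
        = j * ((G m (Suc n))\<^sup>2 - G m (Suc (Suc n)) * G m n)"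
      by (simp add: k_def l_def power2_eq_square algebra_simps del: G.simps)
    then have j: "j = k * G m (Suc (Suc n)) - l * G m (Suc n)"
      unfolding G_cassini by simp
    have "k * G m (Suc n) - l * G m n
        = p * ((G m (Suc n))\<^sup>2 - G m (Suc (Suc n)) * G m n)"
      by (simp add: k_def l_def power2_eq_square algebra_simps del: G.simps)
    then have p_eq: "p = k * G m (Suc n) - l * G m n"
      unfolding G_cassini by simp
    have "\<beta> * j = p + \<beta> ^ Suc n * (k * \<beta> - l)"
      using key[of k l] j p_eq by (metis of_int_diff of_int_mult)
    with p scale have "-1 \<le> k * \<beta> - l" "k * \<beta> - l < 0" by metis+
    then have "\<lfloor>k * \<beta>\<rfloor> + 1 = l" by linarith
    with j show "j \<in> V m \<beta> (Suc n)"
      unfolding V_def by auto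
  qed
qed

text \<open>The shift adds an integer, which leaves the floor, and \<open>\<beta> ^ Suc n\<close>,
  which is less than 1 and so carries past at most one integer. By \<open>in_V_iff\<close> this
  happens exactly on \<open>V\<close>.\<close>

lemma floor_shift:
  fixes \<beta> :: real
  assumes "0 < \<beta>" "\<beta> < 1" and \<beta>: "\<beta>\<^sup>2 - real_of_int m * \<beta> = -1"
  shows "\<lfloor>\<beta> * (j + G m (Suc n))\<rfloor> = \<lfloor>\<beta> * j\<rfloor> + G m n + mismatch m \<beta> (Suc n) j"
proof -
  have d: "0 < \<beta> ^ Suc n" "\<beta> ^ Suc n < 1"
    using assms by (auto simp: power_less_one_iff simp del: power_Suc)
  have "\<beta> * (j + G m (Suc n)) = \<beta> * j + \<beta> ^ Suc n + G m n"
    unfolding of_int_add distrib_left beta_mult_G[OF \<beta>] by simp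
  moreover have "\<lfloor>\<beta> * j + \<beta> ^ Suc n\<rfloor> = \<lfloor>\<beta> * j\<rfloor> + mismatch m \<beta> (Suc n) j"
  proof (cases "j \<in> V m \<beta> (Suc n)")
    case True
    then obtain p :: int where "p - \<beta> ^ Suc n \<le> \<beta> * j" "\<beta> * j < p"
      using in_V_iff[OF assms(1) \<beta>] by blast
    then have "\<lfloor>\<beta> * j\<rfloor> = p - 1" "\<lfloor>\<beta> * j + \<beta> ^ Suc n\<rfloor> = p"
      using d by linarith+
    then show ?thesis using True by (simp add: mismatch_def)
  next
    case False
    \<comment> \<open>The next integer above \<open>\<beta> * j\<close> is a candidate for
      \<open>p\<close> that satisfies the strict bound, so the other bound must fail.\<close>
    then have "\<not> (real_of_int (\<lfloor>\<beta> * j\<rfloor> + 1) - \<beta> ^ Suc n \<le> \<beta> * j)"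
      using in_V_iff[OF assms(1) \<beta>] by (metis floor_correct)
    then have "\<lfloor>\<beta> * j + \<beta> ^ Suc n\<rfloor> = \<lfloor>\<beta> * j\<rfloor>"
      using d by linarith
    then show ?thesis using False by (simp add: mismatch_def)
  qed
  ultimately show ?thesis by simp
qed

lemma sum_telescope_symmetric:
  fixes u :: "int \<Rightarrow> 'a :: ab_group_add"
  shows "(\<Sum>j = - int n..int n. u (j + 1) - u j) = u (int n + 1) - u (- int n)"
proof (induction n)
  case (Suc n)
  have "{- int (Suc n)..int (Suc n)} = insert (- 1 - int n) (insert (int n + 1) {- int n..int n})"
    by auto
  then show ?case using Suc.IH by (simp add: algebra_simps)
qed simp

text \<open>A shift by \<open>g\<close> is split into \<open>g\<close> unit shifts, each telescoping
  to one difference of two values of \<open>u\<close>. The bound does not depend on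
  \<open>n\<close>.\<close>

lemma abs_sum_shift_le:
  fixes u :: "int \<Rightarrow> real"
  assumes "\<And>x y. \<bar>u x - u y\<bar> \<le> c"
  shows "\<bar>\<Sum>j = - int n..int n. u (j + int g) - u j\<bar> \<le> real g * c"
proof (induction g)
  case (Suc g)
  have "(\<Sum>j = - int n..int n. u (j + int (Suc g)) - u j)
      = (\<Sum>j = - int n..int n. u (j + 1 + int g) - u (j + int g))
        + (\<Sum>j = - int n..int n. u (j + int g) - u j)"
    by (simp add: algebra_simps flip: sum.distrib)
  also have "(\<Sum>j = - int n..int n. u (j + 1 + int g) - u (j + int g))
      = u (int n + 1 + int g) - u (- int n + int g)"
    by (rule sum_telescope_symmetric)
  finally show ?case
    using Suc.IH assms[of "int n + 1 + int g" "- int n + int g"]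
    by (simp add: algebra_simps)
qed simp

text \<open>A count that stays within a constant of its expected value has relative error at most
  \<open>C / (2 * real n + 1)\<close>, which tends to 0.\<close>

lemma has_densityI:
  assumes "\<And>n. \<bar>real (card {j \<in> S. - int n \<le> j \<and> j \<le> int n}) - (2 * real n + 1) * d\<bar> \<le> C"
  shows "has_density S d"
  unfolding has_density_def
proof (rule LIMSEQ_I)
  fix r :: real
  assume "r > 0"
  obtain N :: nat where N: "C / r < real N" using reals_Archimedean2 by blast
  show "\<exists>n0. \<forall>n\<ge>n0. norm (real (card {j \<in> S. - int n \<le> j \<and> j \<le> int n}) / (2 * real n + 1) - d) < r"
  proof (intro exI allI impI)
    fix n assume "N \<le> n"
    define a where "a = real (card {j \<in> S. - int n \<le> j \<and> j \<le> int n})"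
    have "\<bar>a - (2 * real n + 1) * d\<bar> \<le> C" unfolding a_def by (rule assms)
    also have "C < real N * r" using N \<open>r > 0\<close> by (simp add: field_simps)
    also have "\<dots> \<le> (2 * real n + 1) * r"
      using \<open>N \<le> n\<close> \<open>r > 0\<close> by (intro mult_right_mono) auto
    finally have "\<bar>a - (2 * real n + 1) * d\<bar> / (2 * real n + 1) < r"
      by (simp add: pos_divide_less_eq mult.commute)
    also have "\<bar>a - (2 * real n + 1) * d\<bar> / (2 * real n + 1)
        = \<bar>(a - (2 * real n + 1) * d) / (2 * real n + 1)\<bar>"
      by (simp add: abs_divide)
    also have "(a - (2 * real n + 1) * d) / (2 * real n + 1) = a / (2 * real n + 1) - d"
      by (simp add: diff_divide_distrib)
    finally show "norm (real (card {j \<in> S. - int n \<le> j \<and> j \<le> int n}) / (2 * real n + 1) - d) < r"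
      by (simp add: a_def)
  qed
qed

lemma density_V:
  fixes \<beta> :: real
  assumes "m \<ge> 2" "0 < \<beta>" "\<beta> < 1" and \<beta>: "\<beta>\<^sup>2 - real_of_int m * \<beta> = -1"
  shows "has_density (V m \<beta> (Suc l)) (\<beta> ^ Suc l)"
proof (rule has_densityI)
  fix n
  define g where "g = nat (G m (Suc l))"
  have g: "G m (Suc l) = int g" using G_nonneg[OF assms(1)] by (simp add: g_def del: G.simps)
  define u where "u x = frac (\<beta> * real_of_int x)" for x
  let ?I = "{- int n..int n}"
  \<comment> \<open>Writing each floor in \<open>floor_shift\<close> as the number minus its
    fractional part makes \<open>G m l\<close> cancel.\<close>
  have mis: "real_of_int (mismatch m \<beta> (Suc l) j) = \<beta> ^ Suc l - (u (j + int g) - u j)" for j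
  proof -
    have "\<beta> * (j + int g) = \<beta> * j + (G m l + \<beta> ^ Suc l)"
      using beta_mult_G[OF \<beta>, of l] by (simp add: g distrib_left)
    then show ?thesis
      using floor_shift[OF assms(2,3) \<beta>, of j l] by (simp add: u_def frac_def g)
  qed
  have "{j \<in> V m \<beta> (Suc l). - int n \<le> j \<and> j \<le> int n} = ?I \<inter> V m \<beta> (Suc l)" by auto
  then have "real (card {j \<in> V m \<beta> (Suc l). - int n \<le> j \<and> j \<le> int n})
      = (\<Sum>j\<in>?I. real_of_int (mismatch m \<beta> (Suc l) j))"
    by (simp add: mismatch_def sum.If_cases if_distrib cong: if_cong)
  also have "\<dots> = (2 * real n + 1) * \<beta> ^ Suc l - (\<Sum>j\<in>?I. u (j + int g) - u j)"
    unfolding mis sum_subtractf by simp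
  finally have "\<bar>real (card {j \<in> V m \<beta> (Suc l). - int n \<le> j \<and> j \<le> int n})
      - (2 * real n + 1) * \<beta> ^ Suc l\<bar> = \<bar>\<Sum>j\<in>?I. u (j + int g) - u j\<bar>"
    by simp
  also have "\<dots> \<le> real g * 1"
  proof (rule abs_sum_shift_le)
    fix x y
    show "\<bar>u x - u y\<bar> \<le> 1" unfolding u_def frac_def by linarith
  qed
  finally show "\<bar>real (card {j \<in> V m \<beta> (Suc l). - int n \<le> j \<and> j \<le> int n})
      - (2 * real n + 1) * \<beta> ^ Suc l\<bar> \<le> real (nat (G m (Suc l)))"
    by (simp add: g_def del: G.simps)
qed

theorem theorem3:
  fixes m :: int and \<beta> :: real and i :: nat
  assumes "m \<ge> 3"
    and "0 < \<beta>" and "\<beta> < 1"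
    and "\<beta>\<^sup>2 - real_of_int m * \<beta> = -1"
    and "i \<ge> 1"
  shows "(\<forall>j::int. \<lfloor>\<beta> * real_of_int (j + G m i)\<rfloor>
            = \<lfloor>\<beta> * real_of_int j\<rfloor> + G m (i - 1) + mismatch m \<beta> i j)
         \<and> has_density (V m \<beta> i) (\<beta> ^ i)"
proof -
  obtain n where i: "i = Suc n"
    using assms(5) by (metis One_nat_def Suc_le_D)
  show ?thesis
    using floor_shift[OF assms(2-4), of _ n] density_V[OF _ assms(2-4), of n] assms(1)
    by (simp add: i del: G.simps power_Suc)
qed

end
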